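(* Let $K$ be a field of characteristic $p>0$ and $\widehat{P}_n=K[[x_1,\ldots,x_n]]$. For any $\sigma\in\operatorname{Aut}_{K,c}(\widehat{P}_n)$ and $a\in\widehat{P}_n$, $$\sigma^{-1}(a)=\sum_{\alpha\in\mathbb{N}^n}\phi_\sigma\big({\partial'}^{[\alpha]}(a)\big)\,x^\alpha ,$$ where ${\partial'}^{[\alpha]}$ and $\phi_\sigma$ are defined in the context.
   Context: $\mathbb{N}=\{0,1,\ldots\}$, $x^\alpha=x_1^{\alpha_1}\cdots x_n^{\alpha_n}$. $\widehat{P}_n$ carries its $\widehat{\mathfrak m}$-adic topology, $\widehat{\mathfrak m}=(x_1,\ldots,x_n)$; infinite sums converge in it. $\operatorname{Aut}_{K,c}(\widehat{P}_n)$ is the group of continuous $K$-algebra automorphisms of $\widehat{P}_n$ (those mapping $\widehat{\mathfrak m}$ into $\widehat{\mathfrak m}$). Given $\sigma$ put $x_i':=\sigma(x_i)$, ${x'}^\beta=\prod{x_i'}^{\beta_i}$. The higher derivations with respect to $x_1',\ldots,x_n'$ are the continuous $K$-linear maps ${\partial'}^{[\alpha]}=\prod_{i=1}^n{\partial_i'}^{[\alpha_i]}:\widehat{P}_n\to\widehat{P}_n$ (formally ${\partial'}^\alpha/\alpha!$ with $\partial_i'=\partial/\partial x_i'$) determined by ${\partial'}^{[\alpha]}({x'}^\beta)=\prod_i\binom{\beta_i}{\alpha_i}{x'}^{\beta-\alpha}$ ($0$ if some $\beta_i<\alpha_i$); ${\partial_i'}^{[j]}$ is the one for $\alpha$ having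 $j$ in position $i$ and $0$ elsewhere. For $1\le i\le n$, $k\ge0$ put $$\phi_{i,k}':=\sum_{j=0}^{p-1}(-1)^j\frac{{x_i'}^{p^kj}}{j!}\big({\partial_i'}^{[p^k]}\big)^j,\qquad \phi_i':=\cdots\phi_{i,k}'\cdots\phi_{i,1}'\phi_{i,0}':\widehat{P}_n\to\widehat{P}_n,$$ where $\phi_i'(u)$ is the limit of $\phi_{i,k}'\cdots\phi_{i,0}'(u)$ as $k\to\infty$. The maps $\phi_i'$ are continuous and commute, and $\phi_\sigma:=\prod_{i=1}^n\phi_i'$. *)

theory Defs
  imports "HOL-Analysis.Analysis"
begin

section \<open>Formal power series in several variables\<close>

text \<open>The variables are indexed by a finite type \<open>'n\<close>, so \<open>('k, 'n) mps\<close> is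
  \<open>K[[x\<^sub>1, \<dots>, x\<^sub>n]]\<close> with \<open>n = CARD('n)\<close>; a multi-index is a vector \<open>\<alpha> :: nat ^ 'n\<close>.\<close>

typedef ('k, 'n) mps = "UNIV :: (nat ^ 'n \<Rightarrow> 'k) set"
  morphisms mps_coeff Abs_mps ..

setup_lifting type_definition_mps

lemma mps_eqI: "(\<And>\<alpha>. mps_coeff f \<alpha> = mps_coeff g \<alpha>) \<Longrightarrow> f = g"
  by transfer auto

lemma finite_le_vec_nat: "finite {\<beta> :: nat ^ 'n. \<beta> \<le> \<alpha>}"
proof -
  have "{\<beta> :: nat ^ 'n. \<beta> \<le> \<alpha>} \<subseteq> vec_lambda ` (PiE UNIV (\<lambda>i. {..\<alpha> $ i}))"
  proof
    fix \<beta> :: "nat ^ 'n"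
    assume "\<beta> \<in> {\<beta>. \<beta> \<le> \<alpha>}"
    then have "vec_nth \<beta> \<in> PiE UNIV (\<lambda>i. {..\<alpha> $ i})"
      by (auto simp: less_eq_vec_def)
    then show "\<beta> \<in> vec_lambda ` (PiE UNIV (\<lambda>i. {..\<alpha> $ i}))"
      by (metis image_eqI vec_nth_inverse)
  qed
  moreover have "finite (PiE (UNIV :: 'n set) (\<lambda>i. {..\<alpha> $ i}))"
    by (intro finite_PiE) auto
  ultimately show ?thesis
    using finite_subset by blast
qed

lemma finite_add_eq_vec_nat: "finite {(\<beta>, \<gamma>). \<beta> + \<gamma> = (\<alpha> :: nat ^ 'n)}"
  by (rule finite_subset[of _ "{\<beta>. \<beta> \<le> \<alpha>} \<times> {\<beta>. \<beta> \<le> \<alpha>}"])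
     (auto simp: finite_le_vec_nat, auto simp: less_eq_vec_def)

instantiation mps :: (comm_ring_1, finite) comm_ring_1
begin

lift_definition zero_mps :: "('a, 'b) mps" is "\<lambda>_. 0" .
lift_definition one_mps :: "('a, 'b) mps" is "\<lambda>\<alpha>. if \<alpha> = 0 then 1 else 0" .
lift_definition plus_mps :: "('a, 'b) mps \<Rightarrow> ('a, 'b) mps \<Rightarrow> ('a, 'b) mps"
  is "\<lambda>f g \<alpha>. f \<alpha> + g \<alpha>" .
lift_definition minus_mps :: "('a, 'b) mps \<Rightarrow> ('a, 'b) mps \<Rightarrow> ('a, 'b) mps"
  is "\<lambda>f g \<alpha>. f \<alpha> - g \<alpha>" .
lift_definition uminus_mps :: "('a, 'b) mps \<Rightarrow> ('a, 'b) mps"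
  is "\<lambda>f \<alpha>. - f \<alpha>" .
lift_definition times_mps :: "('a, 'b) mps \<Rightarrow> ('a, 'b) mps \<Rightarrow> ('a, 'b) mps"
  is "\<lambda>f g \<alpha>. \<Sum>(\<beta>, \<gamma>) | \<beta> + \<gamma> = \<alpha>. f \<beta> * g \<gamma>" .

instance
proof
  fix a b c :: "('a, 'b) mps"
  show "a + b + c = a + (b + c)" by transfer (auto simp: add.assoc)
  show "a + b = b + a" by transfer (auto simp: add.commute)
  show "0 + a = a" by transfer auto
  show "- a + a = 0" by transfer auto
  show "a - b = a + - b" by transfer auto
  show "a * b = b * a"
  proof transfer
    fix a b :: "nat ^ 'b \<Rightarrow> 'a"
    show "(\<lambda>\<alpha>. \<Sum>(\<beta>, \<gamma>) | \<beta> + \<gamma> = \<alpha>. a \<beta> * b \<gamma>) = (\<lambda>\<alpha>. \<Sum>(\<beta>, \<gamma>) | \<beta> + \<gamma> = \<alpha>. b \<beta> * a \<gamma>)"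
      by (intro ext sum.reindex_bij_witness[of _ prod.swap prod.swap])
         (auto simp: add.commute mult.commute)
  qed
  show "1 * a = a"
  proof transfer
    fix a :: "nat ^ 'b \<Rightarrow> 'a"
    have "(\<Sum>(\<beta>, \<gamma>) | \<beta> + \<gamma> = \<alpha>. (if \<beta> = 0 then 1 else 0) * a \<gamma>) = (\<Sum>(\<beta> :: nat ^ 'b, \<gamma>) \<in> {(0, \<alpha>)}. a \<gamma>)" for \<alpha>
      by (rule sum.mono_neutral_cong_right) (auto simp: finite_add_eq_vec_nat split: if_splits)
    then show "(\<lambda>\<alpha>. \<Sum>(\<beta>, \<gamma>) | \<beta> + \<gamma> = \<alpha>. (if \<beta> = 0 then 1 else 0) * a \<gamma>) = a"
      by auto
  qed
  show "(a + b) * c = a * c + b * c"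
    by transfer (auto simp: distrib_right sum.distrib case_prod_unfold)
  show "a * b * c = a * (b * c)"
  proof transfer
    fix a b c :: "nat ^ 'b \<Rightarrow> 'a"
    show "(\<lambda>\<alpha>. \<Sum>(\<beta>, \<gamma>) | \<beta> + \<gamma> = \<alpha>. (\<Sum>(\<beta>', \<gamma>') | \<beta>' + \<gamma>' = \<beta>. a \<beta>' * b \<gamma>') * c \<gamma>) =
          (\<lambda>\<alpha>. \<Sum>(\<beta>, \<gamma>) | \<beta> + \<gamma> = \<alpha>. a \<beta> * (\<Sum>(\<beta>', \<gamma>') | \<beta>' + \<gamma>' = \<gamma>. b \<beta>' * c \<gamma>'))"
    proof
      fix \<alpha> :: "nat ^ 'b"
      have "(\<Sum>(\<beta>, \<gamma>) | \<beta> + \<gamma> = \<alpha>. (\<Sum>(\<beta>', \<gamma>') | \<beta>' + \<gamma>' = \<beta>. a \<beta>' * b \<gamma>') * c \<gamma>) =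
            (\<Sum>x \<in> {(\<beta>, \<gamma>). \<beta> + \<gamma> = \<alpha>}. \<Sum>y \<in> {(\<beta>', \<gamma>'). \<beta>' + \<gamma>' = fst x}. a (fst y) * b (snd y) * c (snd x))"
        by (simp add: sum_distrib_right case_prod_unfold)
      also have "\<dots> = (\<Sum>(x, y) \<in> (SIGMA x:{(\<beta>, \<gamma>). \<beta> + \<gamma> = \<alpha>}. {(\<beta>', \<gamma>'). \<beta>' + \<gamma>' = fst x}). a (fst y) * b (snd y) * c (snd x))"
        by (rule sum.Sigma) (auto simp: finite_add_eq_vec_nat)
      also have "\<dots> = (\<Sum>(x, y) \<in> (SIGMA x:{(\<beta>, \<gamma>). \<beta> + \<gamma> = \<alpha>}. {(\<beta>', \<gamma>'). \<beta>' + \<gamma>' = snd x}). a (fst x) * (b (fst y) * c (snd y)))"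
        by (rule sum.reindex_bij_witness[of _ "\<lambda>((u, _), (v, w)). ((u + v, w), (u, v))"
              "\<lambda>((_, w), (u, v)). ((u, v + w), (v, w))"]) (auto simp: add.assoc mult.assoc)
      also have "\<dots> = (\<Sum>x \<in> {(\<beta>, \<gamma>). \<beta> + \<gamma> = \<alpha>}. \<Sum>y \<in> {(\<beta>', \<gamma>'). \<beta>' + \<gamma>' = snd x}. a (fst x) * (b (fst y) * c (snd y)))"
        by (rule sum.Sigma[symmetric]) (auto simp: finite_add_eq_vec_nat)
      also have "\<dots> = (\<Sum>(\<beta>, \<gamma>) | \<beta> + \<gamma> = \<alpha>. a \<beta> * (\<Sum>(\<beta>', \<gamma>') | \<beta>' + \<gamma>' = \<gamma>. b \<beta>' * c \<gamma>'))"
        by (simp add: sum_distrib_left case_prod_unfold)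
      finally show "(\<Sum>(\<beta>, \<gamma>) | \<beta> + \<gamma> = \<alpha>. (\<Sum>(\<beta>', \<gamma>') | \<beta>' + \<gamma>' = \<beta>. a \<beta>' * b \<gamma>') * c \<gamma>) =
            (\<Sum>(\<beta>, \<gamma>) | \<beta> + \<gamma> = \<alpha>. a \<beta> * (\<Sum>(\<beta>', \<gamma>') | \<beta>' + \<gamma>' = \<gamma>. b \<beta>' * c \<gamma>'))" .
    qed
  qed
  show "(0 :: ('a, 'b) mps) \<noteq> 1"
    by transfer (metis zero_neq_one)
qed

end

lift_definition mps_scale :: "'k::comm_ring_1 \<Rightarrow> ('k, 'n::finite) mps \<Rightarrow> ('k, 'n) mps"
  is "\<lambda>c f \<alpha>. c * f \<alpha>" .

interpretation mps: vector_space "mps_scale :: 'k::field \<Rightarrow> ('k, 'n::finite) mps \<Rightarrow> ('k, 'n) mps"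
  by unfold_locales (transfer; auto simp: algebra_simps)+

lift_definition mps_X :: "'n \<Rightarrow> ('k::comm_ring_1, 'n::finite) mps"
  is "\<lambda>i \<alpha>. if \<alpha> = axis i 1 then 1 else 0" .

definition vpow :: "('n \<Rightarrow> 'a::comm_monoid_mult) \<Rightarrow> nat ^ 'n::finite \<Rightarrow> 'a" where
  "vpow x \<alpha> = (\<Prod>i\<in>UNIV. x i ^ (\<alpha> $ i))"

section \<open>The topology given by powers of the maximal ideal\<close>

definition ideal_gen :: "'a::comm_ring_1 set \<Rightarrow> 'a set" where
  "ideal_gen = module.span (*)"

definition mps_max :: "('k::comm_ring_1, 'n::finite) mps set" where
  "mps_max = ideal_gen (range mps_X)"

primrec mps_max_pow :: "nat \<Rightarrow> ('k::comm_ring_1, 'n::finite) mps set" where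
  "mps_max_pow 0 = UNIV"
| "mps_max_pow (Suc N) = ideal_gen {f * g | f g. f \<in> mps_max \<and> g \<in> mps_max_pow N}"

interpretation ring_module: module "(*) :: 'a::comm_ring_1 \<Rightarrow> 'a \<Rightarrow> 'a"
  by unfold_locales (auto simp: algebra_simps)

lemma mps_coeff_add: "mps_coeff (f + g) \<alpha> = mps_coeff f \<alpha> + mps_coeff g \<alpha>"
  by transfer auto

lemma mps_coeff_mult:
  "mps_coeff (f * g) \<alpha> = (\<Sum>(\<beta>, \<gamma>) | \<beta> + \<gamma> = \<alpha>. mps_coeff f \<beta> * mps_coeff g \<gamma>)"
  by transfer auto

lemma mps_coeff_0: "mps_coeff 0 \<alpha> = 0"
  by transfer auto

lemma mps_max_pow_coeff:
  "f \<in> mps_max_pow N \<Longrightarrow> (\<Sum>i\<in>UNIV. \<alpha> $ i) < N \<Longrightarrow> mps_coeff f \<alpha> = 0"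
proof (induction N arbitrary: f \<alpha>)
  case (Suc N)
  define T :: "nat \<Rightarrow> ('a, 'b) mps set"
    where "T M = {f. \<forall>\<alpha>. (\<Sum>i\<in>UNIV. \<alpha> $ i) < M \<longrightarrow> mps_coeff f \<alpha> = 0}" for M
  have sub: "ring_module.subspace (T M)" for M
  proof (rule ring_module.subspaceI)
    fix c g :: "('a, 'b) mps"
    assume g: "g \<in> T M"
    show "c * g \<in> T M"
      unfolding T_def
    proof (intro CollectI allI impI)
      fix \<alpha> :: "nat ^ 'b"
      assume "(\<Sum>i\<in>UNIV. \<alpha> $ i) < M"
      then have "mps_coeff g \<gamma> = 0" if "\<beta> + \<gamma> = \<alpha>" for \<beta> \<gamma>
        using g that by (auto simp: T_def sum.distrib)
      then show "mps_coeff (c * g) \<alpha> = 0"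
        by (auto simp: mps_coeff_mult intro!: sum.neutral)
    qed
  qed (auto simp: T_def mps_coeff_0 mps_coeff_add)
  have "mps_coeff (mps_X i :: ('a, 'b) mps) 0 = 0" for i
    by transfer (simp add: axis_eq_0_iff)
  then have "range mps_X \<subseteq> T 1"
    by (auto simp: T_def vec_eq_iff simp flip: zero_vec_def) (metis vec_eq_iff zero_index)
  then have m: "mps_max \<subseteq> T 1"
    unfolding mps_max_def ideal_gen_def by (intro ring_module.span_minimal sub)
  have "{f * g | f g. f \<in> mps_max \<and> g \<in> mps_max_pow N} \<subseteq> T (Suc N)"
  proof safe
    fix f g :: "('a, 'b) mps"
    assume f: "f \<in> mps_max" and g: "g \<in> mps_max_pow N"
    show "f * g \<in> T (Suc N)"
      unfolding T_def
    proof (intro CollectI allI impI)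
      fix \<alpha> :: "nat ^ 'b"
      assume \<alpha>: "(\<Sum>i\<in>UNIV. \<alpha> $ i) < Suc N"
      have "mps_coeff f \<beta> * mps_coeff g \<gamma> = 0" if "\<beta> + \<gamma> = \<alpha>" for \<beta> \<gamma>
      proof (cases "(\<Sum>i\<in>UNIV. \<beta> $ i) = 0")
        case True
        with f m show ?thesis by (auto simp: T_def)
      next
        case False
        moreover have "(\<Sum>i\<in>UNIV. \<alpha> $ i) = (\<Sum>i\<in>UNIV. \<beta> $ i) + (\<Sum>i\<in>UNIV. \<gamma> $ i)"
          by (simp add: that[symmetric] sum.distrib)
        ultimately have "(\<Sum>i\<in>UNIV. \<gamma> $ i) < N" using \<alpha> by linarith
        with Suc.IH[OF g] show ?thesis by simp
      qed
      then show "mps_coeff (f * g) \<alpha> = 0"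
        by (auto simp: mps_coeff_mult intro!: sum.neutral)
    qed
  qed
  then have "mps_max_pow (Suc N) \<subseteq> T (Suc N)"
    by (simp add: ideal_gen_def ring_module.span_minimal sub)
  with Suc.prems show ?case by (auto simp: T_def)
qed auto

lemma mps_max_pow_Suc_subset: "mps_max_pow (Suc N) \<subseteq> mps_max_pow N"
proof -
  have "ring_module.subspace (mps_max_pow N :: ('a, 'b) mps set)"
    by (cases N) (auto simp: ideal_gen_def)
  then show ?thesis
    unfolding mps_max_pow.simps ideal_gen_def
    by (intro ring_module.span_minimal) (auto intro: ring_module.subspace_scale)
qed

lemma mps_max_pow_antimono: "M \<le> N \<Longrightarrow> mps_max_pow N \<subseteq> mps_max_pow M"
  using mps_max_pow_Suc_subset by (rule lift_Suc_antimono_le)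

lemma subspace_mps_max_pow: "ring_module.subspace (mps_max_pow N)"
  by (cases N) (auto simp: ideal_gen_def)

instantiation mps :: (comm_ring_1, finite) t2_space
begin

definition open_mps :: "('a, 'b) mps set \<Rightarrow> bool" where
  "open_mps U \<longleftrightarrow> (\<forall>f\<in>U. \<exists>N. \<forall>g. g - f \<in> mps_max_pow N \<longrightarrow> g \<in> U)"

instance
proof
  show "open (UNIV :: ('a, 'b) mps set)"
    by (simp add: open_mps_def)
next
  fix S T :: "('a, 'b) mps set"
  assume "open S" "open T"
  show "open (S \<inter> T)"
    unfolding open_mps_def
  proof
    fix f assume "f \<in> S \<inter> T"
    with \<open>open S\<close> \<open>open T\<close> obtain M N
      where "\<And>g. g - f \<in> mps_max_pow M \<Longrightarrow> g \<in> S" "\<And>g. g - f \<in> mps_max_pow N \<Longrightarrow> g \<in> T"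
      unfolding open_mps_def by blast
    then show "\<exists>N. \<forall>g. g - f \<in> mps_max_pow N \<longrightarrow> g \<in> S \<inter> T"
      using mps_max_pow_antimono[of M "max M N"] mps_max_pow_antimono[of N "max M N"]
      by (intro exI[of _ "max M N"]) auto
  qed
next
  fix \<K> :: "('a, 'b) mps set set"
  assume "\<forall>S\<in>\<K>. open S"
  then show "open (\<Union>\<K>)"
    unfolding open_mps_def by (meson UnionE UnionI)
next
  fix f g :: "('a, 'b) mps"
  assume "f \<noteq> g"
  then obtain \<alpha> where \<alpha>: "mps_coeff f \<alpha> \<noteq> mps_coeff g \<alpha>"
    using mps_eqI by blast
  define N where "N = Suc (\<Sum>i\<in>UNIV. \<alpha> $ i)"
  define B where "B h = {h'. h' - h \<in> mps_max_pow N}" for h :: "('a, 'b) mps"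
  have "open (B h)" for h
    unfolding open_mps_def
  proof
    fix h' assume "h' \<in> B h"
    then have "h'' \<in> B h" if "h'' - h' \<in> mps_max_pow N" for h''
      using ring_module.subspace_add[OF subspace_mps_max_pow that, of "h' - h"] by (auto simp: B_def)
    then show "\<exists>M. \<forall>h''. h'' - h' \<in> mps_max_pow M \<longrightarrow> h'' \<in> B h" by blast
  qed
  moreover have "h \<in> B h" for h
    using ring_module.subspace_0[OF subspace_mps_max_pow] by (simp add: B_def)
  moreover have "B f \<inter> B g = {}"
  proof (rule equals0I)
    fix h assume "h \<in> B f \<inter> B g"
    then have "mps_coeff (h - f) \<alpha> = 0" "mps_coeff (h - g) \<alpha> = 0"
      using mps_max_pow_coeff[of "h - f" N \<alpha>] mps_max_pow_coeff[of "h - g" N \<alpha>] by (simp_all add: B_def N_def del: mps_max_pow.simps)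
    moreover have "mps_coeff (h - f) \<alpha> = mps_coeff h \<alpha> - mps_coeff f \<alpha>"
      "mps_coeff (h - g) \<alpha> = mps_coeff h \<alpha> - mps_coeff g \<alpha>"
      by (transfer, simp)+
    ultimately show False using \<alpha> by simp
  qed
  ultimately show "\<exists>U V. open U \<and> open V \<and> f \<in> U \<and> g \<in> V \<and> U \<inter> V = {}" by blast
qed

end

section \<open>Continuous automorphisms, higher derivations and the maps \<open>\<phi>\<close>\<close>

definition mps_Aut :: "(('k::field, 'n::finite) mps \<Rightarrow> ('k, 'n) mps) set" where
  "mps_Aut = {\<sigma>. bij \<sigma> \<and> Vector_Spaces.linear mps_scale mps_scale \<sigma> \<and> \<sigma> 1 = 1 \<and>
     (\<forall>f g. \<sigma> (f * g) = \<sigma> f * \<sigma> g) \<and> continuous_on UNIV \<sigma>}"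

text \<open>In the following, \<open>y\<close> is the system of coordinates \<open>x\<^sub>1', \<dots>, x\<^sub>n'\<close>. In the defining formula
  of the higher derivations, the binomial product is \<open>0\<close> if \<open>\<beta> $ i < \<alpha> $ i\<close> for some \<open>i\<close>, so the
  truncated subtraction in \<open>\<beta> - \<alpha>\<close> is harmless.\<close>

definition hderiv ::
    "('n \<Rightarrow> ('k::field, 'n::finite) mps) \<Rightarrow> nat ^ 'n \<Rightarrow> ('k, 'n) mps \<Rightarrow> ('k, 'n) mps" where
  "hderiv y \<alpha> = (THE D. Vector_Spaces.linear mps_scale mps_scale D \<and> continuous_on UNIV D \<and>
     (\<forall>\<beta>. D (vpow y \<beta>) =
        mps_scale (of_nat (\<Prod>i\<in>UNIV. (\<beta> $ i) choose (\<alpha> $ i))) (vpow y (\<beta> - \<alpha>))))"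

definition phi_ik ::
    "nat \<Rightarrow> ('n \<Rightarrow> ('k::field, 'n::finite) mps) \<Rightarrow> 'n \<Rightarrow> nat \<Rightarrow> ('k, 'n) mps \<Rightarrow> ('k, 'n) mps" where
  "phi_ik p y i k u = (\<Sum>j<p. mps_scale ((- 1) ^ j / of_nat (fact j))
     (y i ^ (p ^ k * j) * (hderiv y (axis i (p ^ k)) ^^ j) u))"

primrec phi_upto ::
    "nat \<Rightarrow> ('n \<Rightarrow> ('k::field, 'n::finite) mps) \<Rightarrow> 'n \<Rightarrow> nat \<Rightarrow> ('k, 'n) mps \<Rightarrow> ('k, 'n) mps" where
  "phi_upto p y i 0 = phi_ik p y i 0"
| "phi_upto p y i (Suc k) = phi_ik p y i (Suc k) \<circ> phi_upto p y i k"

definition phi_i ::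
    "nat \<Rightarrow> ('n \<Rightarrow> ('k::field, 'n::finite) mps) \<Rightarrow> 'n \<Rightarrow> ('k, 'n) mps \<Rightarrow> ('k, 'n) mps" where
  "phi_i p y i u = lim (\<lambda>k. phi_upto p y i k u)"

text \<open>The product of the commuting maps \<open>phi_i\<close> over the unordered index type \<open>'n\<close>.\<close>

definition phi_sigma ::
    "nat \<Rightarrow> (('k::field, 'n::finite) mps \<Rightarrow> ('k, 'n) mps) \<Rightarrow> ('k, 'n) mps \<Rightarrow> ('k, 'n) mps" where
  "phi_sigma p \<sigma> = Finite_Set.fold (\<lambda>i f. phi_i p (\<lambda>i. \<sigma> (mps_X i)) i \<circ> f) id UNIV"

end

theory Submission
  imports Defs
begin

text \<open>Transport of structure by \<open>\<sigma>\<close> turns \<open>x\<^sub>i\<close> into \<open>x\<^sub>i'\<close>, so every operator built from the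
  coordinates \<open>x'\<close> is the conjugate by \<open>\<sigma>\<close> of the same operator built from \<open>x\<close>. For the higher
  derivations this is \<open>hderiv_eq\<close>; their characterisation by values on monomials together with
  continuity carries over because \<open>\<sigma>\<inverse>\<close> is continuous as well (\<open>continuous_inv\<close>).

  In the standard coordinates all maps involved act on monomials. The operator
  \<open>x\<^sub>i ^ (j p^k) (\<partial>\<^sub>i ^ [p^k]) ^ j\<close> is diagonal: on \<open>x ^ \<beta>\<close> it is multiplication by
  \<open>j! (m choose j)\<close>, where \<open>m = \<beta>\<^sub>i div p ^ k\<close>, since \<open>b choose p ^ k\<close> is congruent to
  \<open>b div p ^ k\<close> modulo \<open>p\<close>. Hence \<open>\<phi>\<^sub>i\<^sub>,\<^sub>k\<close> multiplies \<open>x ^ \<beta>\<close> by the truncated alternating sum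
  of the \<open>m choose j\<close> over \<open>j < p\<close>. That is \<open>1\<close> if \<open>\<beta>\<^sub>i = 0\<close>, and if \<open>\<beta>\<^sub>i > 0\<close> it is \<open>0\<close> for the
  \<open>k\<close> with \<open>p ^ k \<le> \<beta>\<^sub>i < p ^ (k + 1)\<close>: then \<open>0 < m < p\<close>, so the sum is the complete alternating
  sum of a row of Pascal's triangle. The infinite product over \<open>k\<close> is therefore the
  substitution \<open>x\<^sub>i = 0\<close> (\<open>phi_i_eq\<close>), and \<open>\<phi>\<^sub>\<sigma> u\<close> is the constant term of \<open>\<sigma>\<inverse> u\<close> (\<open>phi_sigma_eq\<close>).

  Applied to the \<open>\<alpha>\<close>-th higher derivative of \<open>a\<close>, this gives the constant term of the \<open>\<alpha>\<close>-th
  Hasse derivative of \<open>\<sigma>\<inverse> a\<close>, that is the coefficient of \<open>x ^ \<alpha>\<close> in \<open>\<sigma>\<inverse> a\<close>. The formula is thus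
  the expansion of \<open>\<sigma>\<inverse> a\<close> into monomials (\<open>has_sum_mps_monom\<close>).\<close>

section \<open>Monomials and orders\<close>

(* As a simplification rule it reassociates products against mult.assoc. *)
declare ring_module.scale_scale [simp del]

abbreviation total_degree :: "nat ^ 'n::finite \<Rightarrow> nat" where
  "total_degree \<alpha> \<equiv> (\<Sum>i\<in>UNIV. \<alpha> $ i)"

lift_definition mps_monom :: "nat ^ 'n::finite \<Rightarrow> ('k::comm_ring_1, 'n) mps"
  is "\<lambda>\<beta> \<alpha>. if \<alpha> = \<beta> then 1 else 0" .

lemma mps_coeff_monom: "mps_coeff (mps_monom \<beta>) \<alpha> = (if \<alpha> = \<beta> then 1 else 0)"
  by transfer auto

lemma mps_coeff_scale: "mps_coeff (mps_scale c f) \<alpha> = c * mps_coeff f \<alpha>"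
  by transfer auto

lemma mps_coeff_diff: "mps_coeff (f - g) \<alpha> = mps_coeff f \<alpha> - mps_coeff g \<alpha>"
  by transfer auto

lemma mps_coeff_sum: "mps_coeff (sum f A) \<alpha> = (\<Sum>x\<in>A. mps_coeff (f x) \<alpha>)"
  by (induction A rule: infinite_finite_induct) (auto simp: mps_coeff_0 mps_coeff_add)

lemma mps_coeff_1: "mps_coeff 1 \<alpha> = (if \<alpha> = 0 then 1 else 0)"
  by transfer auto

lemma mps_coeff_X: "mps_coeff (mps_X i) \<alpha> = (if \<alpha> = axis i 1 then 1 else 0)"
  by transfer auto

lemma mps_scale_mult_left: "mps_scale c f * g = mps_scale c (f * g)"
  by (rule mps_eqI) (simp add: mps_coeff_scale mps_coeff_mult sum_distrib_left case_prod_unfold mult.assoc)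

lemma mps_coeff_monom_mult:
  fixes \<beta> :: "nat ^ 'n::finite" and f :: "('k::comm_ring_1, 'n) mps"
  shows "mps_coeff (mps_monom \<beta> * f) \<alpha> = (if \<beta> \<le> \<alpha> then mps_coeff f (\<alpha> - \<beta>) else 0)"
proof (cases "\<beta> \<le> \<alpha>")
  case True
  then have eq: "\<beta> + (\<alpha> - \<beta>) = \<alpha>"
    by (auto simp: vec_eq_iff less_eq_vec_def)
  have "mps_coeff (mps_monom \<beta> * f) \<alpha> =
      (\<Sum>(\<beta>', \<gamma>) \<in> {(\<beta>, \<alpha> - \<beta>)}. mps_coeff (mps_monom \<beta> :: ('k, 'n) mps) \<beta>' * mps_coeff f \<gamma>)"
    unfolding mps_coeff_mult using eq
    by (intro sum.mono_neutral_cong_right)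
       (auto simp: finite_add_eq_vec_nat mps_coeff_monom split: if_splits)
  with True show ?thesis by (simp add: mps_coeff_monom)
next
  case False
  then have "\<beta>' \<noteq> \<beta>" if "\<beta>' + \<gamma> = \<alpha>" for \<beta>' \<gamma>
    using that by (auto simp: less_eq_vec_def)
  with False show ?thesis
    by (auto simp: mps_coeff_mult mps_coeff_monom intro!: sum.neutral)
qed

lemma mps_monom_0: "mps_monom 0 = 1"
  by transfer auto

lemma mps_monom_mult: "mps_monom \<alpha> * mps_monom \<beta> = mps_monom (\<alpha> + \<beta>)"
proof (rule mps_eqI)
  fix \<gamma>
  have "(\<alpha> \<le> \<gamma> \<and> \<gamma> - \<alpha> = \<beta>) \<longleftrightarrow> \<gamma> = \<alpha> + \<beta>"
    by (auto simp: vec_eq_iff less_eq_vec_def) (metis le_add_diff_inverse)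
  then show "mps_coeff (mps_monom \<alpha> * mps_monom \<beta>) \<gamma> = mps_coeff (mps_monom (\<alpha> + \<beta>)) \<gamma>"
    by (auto simp: mps_coeff_monom_mult mps_coeff_monom)
qed

lemma axis_nat_0: "axis i (0 :: nat) = 0"
  by (simp add: axis_eq_0_iff)

lemma mps_X_power: "mps_X i ^ m = (mps_monom (axis i m) :: ('k::comm_ring_1, 'n::finite) mps)"
proof (induction m)
  case 0
  then show ?case by (simp add: mps_monom_0 axis_nat_0)
next
  case (Suc m)
  have "axis i 1 + axis i m = axis i (Suc m)"
    by (auto simp: vec_eq_iff axis_def)
  moreover have "(mps_X i :: ('k, 'n) mps) = mps_monom (axis i 1)"
    by transfer auto
  ultimately show ?case using Suc by (simp add: mps_monom_mult)
qed

lemma vpow_mps_X: "vpow mps_X \<alpha> = (mps_monom \<alpha> :: ('k::comm_ring_1, 'n::finite) mps)"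
proof -
  have "(\<Prod>i\<in>A. mps_X i ^ (\<alpha> $ i)) = (mps_monom (\<Sum>i\<in>A. axis i (\<alpha> $ i)) :: ('k, 'n) mps)" for A
    by (induction A rule: infinite_finite_induct) (auto simp: mps_monom_0 mps_X_power mps_monom_mult)
  moreover have "(\<Sum>i\<in>UNIV. axis i (\<alpha> $ i)) = \<alpha>"
    by (simp add: vec_eq_iff axis_def if_distrib[of "\<lambda>f. f _"] cong: if_cong)
  ultimately show ?thesis by (simp add: vpow_def)
qed

lemma mps_coeff_X_power_mult:
  "mps_coeff (mps_X i ^ m * f) \<alpha> = (if m \<le> \<alpha> $ i then mps_coeff f (\<alpha> - axis i m) else 0)"
proof -
  have "axis i m \<le> \<alpha> \<longleftrightarrow> m \<le> \<alpha> $ i"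
    by (auto simp: less_eq_vec_def axis_def)
  then show ?thesis by (simp add: mps_X_power mps_coeff_monom_mult)
qed

lemma mps_coeff_mult_0: "mps_coeff (f * g) 0 = mps_coeff f 0 * mps_coeff g 0"
proof -
  have "{(\<beta>, \<gamma>). \<beta> + \<gamma> = (0 :: nat ^ 'b)} = {(0, 0)}"
    by (auto simp: vec_eq_iff)
  then show ?thesis by (simp add: mps_coeff_mult)
qed

text \<open>The coefficientwise description of the powers of the maximal ideal, see \<open>mps_max_pow_iff\<close>.\<close>

definition order_ge :: "nat \<Rightarrow> ('k::comm_ring_1, 'n::finite) mps \<Rightarrow> bool" where
  "order_ge N f \<longleftrightarrow> (\<forall>\<alpha>. total_degree \<alpha> < N \<longrightarrow> mps_coeff f \<alpha> = 0)"

text \<open>Each monomial of positive degree is handed to one of the variables dividing it. The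
  decomposition drives the inductions on the order below, both for the powers of the maximal
  ideal and for automorphisms.\<close>

lemma order_ge_Suc_decompose:
  fixes f :: "('k::comm_ring_1, 'n::finite) mps"
  assumes "order_ge (Suc N) f"
  obtains g where "f = (\<Sum>i\<in>UNIV. mps_X i * g i)" "\<And>i. order_ge N (g i)"
proof
  define c where "c \<alpha> = (SOME i. \<alpha> $ i \<noteq> 0)" for \<alpha> :: "nat ^ 'n"
  define g where "g i = Abs_mps (\<lambda>\<gamma>. if c (\<gamma> + axis i 1) = i then mps_coeff f (\<gamma> + axis i 1) else 0)" for i
  have g: "mps_coeff (g i) \<gamma> = (if c (\<gamma> + axis i 1) = i then mps_coeff f (\<gamma> + axis i 1) else 0)" for i \<gamma>
    by (simp add: g_def Abs_mps_inverse)
  have X: "mps_coeff (mps_X i * g i) \<alpha> = (if 1 \<le> \<alpha> $ i \<and> c \<alpha> = i then mps_coeff f \<alpha> else 0)" for i \<alpha>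
  proof -
    have "\<alpha> - axis i 1 + axis i 1 = \<alpha>" if "1 \<le> \<alpha> $ i"
      using that by (auto simp: vec_eq_iff axis_def)
    then show ?thesis
      using mps_coeff_X_power_mult[of i 1 "g i" \<alpha>] by (auto simp: g)
  qed
  show "f = (\<Sum>i\<in>UNIV. mps_X i * g i)"
  proof (rule mps_eqI)
    fix \<alpha>
    show "mps_coeff f \<alpha> = mps_coeff (\<Sum>i\<in>UNIV. mps_X i * g i) \<alpha>"
    proof (cases "\<alpha> = 0")
      case True
      then have "mps_coeff f \<alpha> = 0" using assms by (auto simp: order_ge_def)
      then show ?thesis using True by (simp add: mps_coeff_sum X)
    next
      case False
      then have "\<exists>i. \<alpha> $ i \<noteq> 0" by (auto simp: vec_eq_iff)
      then have "\<alpha> $ c \<alpha> \<noteq> 0" unfolding c_def by (rule someI_ex)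
      then have "mps_coeff (mps_X i * g i) \<alpha> = (if c \<alpha> = i then mps_coeff f \<alpha> else 0)" for i
        by (auto simp: X)
      then show ?thesis by (simp add: mps_coeff_sum)
    qed
  qed
  show "order_ge N (g i)" for i
    unfolding order_ge_def
  proof (intro allI impI)
    fix \<alpha> :: "nat ^ 'n"
    assume "total_degree \<alpha> < N"
    moreover have "total_degree (\<alpha> + axis i 1) = Suc (total_degree \<alpha>)"
      by (simp add: sum.distrib axis_def)
    ultimately have "mps_coeff f (\<alpha> + axis i 1) = 0"
      using assms unfolding order_ge_def by (metis Suc_less_eq)
    then show "mps_coeff (g i) \<alpha> = 0"
      unfolding g by (simp only: if_cancel)
  qed
qed

lemma order_ge_mult:
  assumes "order_ge M f" "order_ge N g"
  shows "order_ge (M + N) (f * g)"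
  unfolding order_ge_def
proof (intro allI impI)
  fix \<alpha> :: "nat ^ 'b"
  assume \<alpha>: "total_degree \<alpha> < M + N"
  have "mps_coeff f \<beta> * mps_coeff g \<gamma> = 0" if "\<beta> + \<gamma> = \<alpha>" for \<beta> \<gamma>
  proof -
    have "total_degree \<alpha> = total_degree \<beta> + total_degree \<gamma>"
      by (simp add: that[symmetric] sum.distrib)
    with \<alpha> have "total_degree \<beta> < M \<or> total_degree \<gamma> < N" by linarith
    with assms show ?thesis by (auto simp: order_ge_def)
  qed
  then show "mps_coeff (f * g) \<alpha> = 0"
    by (auto simp: mps_coeff_mult intro!: sum.neutral)
qed

lemma order_ge_sum: "(\<And>x. x \<in> A \<Longrightarrow> order_ge N (f x)) \<Longrightarrow> order_ge N (sum f A)"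
  by (auto simp: order_ge_def mps_coeff_sum)

lemma order_ge_Suc_0: "order_ge (Suc 0) f \<longleftrightarrow> mps_coeff f 0 = 0"
proof -
  have "total_degree \<alpha> = 0 \<longleftrightarrow> \<alpha> = 0" for \<alpha> :: "nat ^ 'b"
    by (auto simp: vec_eq_iff)
  then show ?thesis by (simp add: order_ge_def less_Suc0 del: sum_eq_0_iff)
qed

lemma order_ge_imp_mps_max_pow: "order_ge N f \<Longrightarrow> f \<in> mps_max_pow N"
proof (induction N arbitrary: f)
  case (Suc N)
  from Suc.prems obtain g where f: "f = (\<Sum>i\<in>UNIV. mps_X i * g i)" and g: "\<And>i. order_ge N (g i)"
    by (rule order_ge_Suc_decompose) blast
  have "mps_X i \<in> mps_max" for i :: 'b
    by (auto simp: mps_max_def ideal_gen_def intro: ring_module.span_base)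
  then have "mps_X i * g i \<in> mps_max_pow (Suc N)" for i
    using Suc.IH[OF g] by (auto simp: ideal_gen_def intro!: ring_module.span_base)
  then show ?case
    unfolding f by (intro ring_module.subspace_sum subspace_mps_max_pow)
qed auto

lemma mps_max_pow_iff: "f \<in> mps_max_pow N \<longleftrightarrow> order_ge N f"
  using mps_max_pow_coeff order_ge_imp_mps_max_pow by (auto simp: order_ge_def)

section \<open>Convergence is eventual constancy of each coefficient\<close>

lemma finite_total_degree_less: "finite {\<alpha> :: nat ^ 'n::finite. total_degree \<alpha> < N}"
proof (rule finite_subset)
  show "{\<alpha> :: nat ^ 'n. total_degree \<alpha> < N} \<subseteq> {\<alpha>. \<alpha> \<le> (\<chi> i. N)}"
  proof
    fix \<alpha> :: "nat ^ 'n"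
    assume "\<alpha> \<in> {\<alpha>. total_degree \<alpha> < N}"
    moreover have "\<alpha> $ i \<le> total_degree \<alpha>" for i
      by (rule member_le_sum) auto
    ultimately show "\<alpha> \<in> {\<alpha>. \<alpha> \<le> (\<chi> i. N)}"
      by (auto simp: less_eq_vec_def intro: order_trans less_imp_le)
  qed
qed (rule finite_le_vec_nat)

lemma open_mps_ball: "open {g. order_ge N (g - f)}"
  unfolding open_mps_def mps_max_pow_iff
  by (auto intro!: exI[of _ N] simp: order_ge_def mps_coeff_diff)

text \<open>Only finitely many coefficients matter modulo a power of the maximal ideal.\<close>

lemma tendsto_mps_iff:
  fixes f :: "'a \<Rightarrow> ('k::comm_ring_1, 'n::finite) mps"
  shows "(f \<longlongrightarrow> L) F \<longleftrightarrow> (\<forall>\<alpha>. eventually (\<lambda>x. mps_coeff (f x) \<alpha> = mps_coeff L \<alpha>) F)"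
proof
  assume lim: "(f \<longlongrightarrow> L) F"
  show "\<forall>\<alpha>. eventually (\<lambda>x. mps_coeff (f x) \<alpha> = mps_coeff L \<alpha>) F"
  proof
    fix \<alpha> :: "nat ^ 'n"
    let ?U = "{g. order_ge (Suc (total_degree \<alpha>)) (g - L)}"
    have "L \<in> ?U" by (auto simp: order_ge_def mps_coeff_0)
    then have "eventually (\<lambda>x. f x \<in> ?U) F"
      using lim open_mps_ball by (rule topological_tendstoD[rotated 2])
    then show "eventually (\<lambda>x. mps_coeff (f x) \<alpha> = mps_coeff L \<alpha>) F"
      by eventually_elim (auto simp: order_ge_def mps_coeff_diff)
  qed
next
  assume ev: "\<forall>\<alpha>. eventually (\<lambda>x. mps_coeff (f x) \<alpha> = mps_coeff L \<alpha>) F"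
  show "(f \<longlongrightarrow> L) F"
  proof (rule topological_tendstoI)
    fix S assume "open S" "L \<in> S"
    then obtain N where N: "\<And>g. order_ge N (g - L) \<Longrightarrow> g \<in> S"
      unfolding open_mps_def mps_max_pow_iff by blast
    have "eventually (\<lambda>x. \<forall>\<alpha>\<in>{\<alpha>. total_degree \<alpha> < N}. mps_coeff (f x) \<alpha> = mps_coeff L \<alpha>) F"
      using ev by (intro eventually_ball_finite finite_total_degree_less) auto
    then show "eventually (\<lambda>x. f x \<in> S) F"
      by eventually_elim (auto intro!: N simp: order_ge_def mps_coeff_diff)
  qed
qed

lemma continuous_on_mps_iff:
  fixes D :: "('k::comm_ring_1, 'n::finite) mps \<Rightarrow> ('k, 'n) mps"
  shows "continuous_on UNIV D \<longleftrightarrow> (\<forall>f. (D \<longlongrightarrow> D f) (at f))"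
  by (simp add: continuous_on_def)

lemma eventually_mps_coeff_eq: "eventually (\<lambda>g. mps_coeff g \<alpha> = mps_coeff f \<alpha>) (at f)"
  using tendsto_mps_iff[of "\<lambda>x. x" f "at f"] by (auto simp: tendsto_ident_at)

lemma has_sum_mps_monom:
  fixes f :: "('k::field, 'n::finite) mps"
  shows "((\<lambda>\<alpha>. mps_scale (mps_coeff f \<alpha>) (mps_monom \<alpha>)) has_sum f) UNIV"
  unfolding has_sum_def tendsto_mps_iff
proof
  fix \<alpha> :: "nat ^ 'n"
  have "\<forall>\<^sub>F A in finite_subsets_at_top (UNIV :: (nat ^ 'n) set). finite A \<and> {\<alpha>} \<subseteq> A \<and> A \<subseteq> UNIV"
    by (auto simp: eventually_finite_subsets_at_top intro!: exI[of _ "{\<alpha>}"])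
  then show "\<forall>\<^sub>F A in finite_subsets_at_top UNIV.
      mps_coeff (\<Sum>\<beta>\<in>A. mps_scale (mps_coeff f \<beta>) (mps_monom \<beta>)) \<alpha> = mps_coeff f \<alpha>"
    by eventually_elim (simp add: mps_coeff_sum mps_coeff_scale mps_coeff_monom if_distrib cong: if_cong)
qed

section \<open>Continuous automorphisms\<close>

lemma linear_mps_iff:
  "Vector_Spaces.linear mps_scale mps_scale (D :: ('k::field, 'n::finite) mps \<Rightarrow> ('k, 'n) mps) \<longleftrightarrow>
    (\<forall>f g. D (f + g) = D f + D g) \<and> (\<forall>c f. D (mps_scale c f) = mps_scale c (D f))"
  by (simp add: Vector_Spaces.linear_iff mps.vector_space_axioms)

lemma linear_mps_sum:
  fixes D :: "('k::field, 'n::finite) mps \<Rightarrow> ('k, 'n) mps"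
  assumes "Vector_Spaces.linear mps_scale mps_scale D"
  shows "D (sum f A) = (\<Sum>x\<in>A. D (f x))"
proof -
  have add: "D (f + g) = D f + D g" for f g
    using assms by (simp add: linear_mps_iff)
  have "D 0 = 0" using add[of 0 0] by simp
  then show ?thesis
    by (induction A rule: infinite_finite_induct) (auto simp: add)
qed

text \<open>The monomials span a dense subspace. This gives the uniqueness in the definition of the
  higher derivations.\<close>

lemma linear_continuous_mps_eqI:
  fixes D E :: "('k::field, 'n::finite) mps \<Rightarrow> ('k, 'n) mps"
  assumes "Vector_Spaces.linear mps_scale mps_scale D" "continuous_on UNIV D"
    and "Vector_Spaces.linear mps_scale mps_scale E" "continuous_on UNIV E"
    and eq: "\<And>\<beta>. D (mps_monom \<beta>) = E (mps_monom \<beta>)"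
  shows "D = E"
proof
  fix f :: "('k, 'n) mps"
  define g where "g \<alpha> = mps_scale (mps_coeff f \<alpha>) (mps_monom \<alpha>)" for \<alpha> :: "nat ^ 'n"
  have sums: "((L \<circ> g) has_sum L f) UNIV"
    if "Vector_Spaces.linear mps_scale mps_scale L" "continuous_on UNIV L"
    for L :: "('k, 'n) mps \<Rightarrow> ('k, 'n) mps"
    using that has_sum_mps_monom[of f, folded g_def]
    by (intro has_sum_comm_additive_general)
       (auto simp: linear_mps_sum continuous_on_mps_iff)
  have "D \<circ> g = E \<circ> g"
    using assms by (auto simp: g_def linear_mps_iff fun_eq_iff)
  then show "D f = E f"
    using sums[OF assms(1,2)] sums[OF assms(3,4)] by (metis infsumI)
qed

locale mps_automorphism =
  fixes \<sigma> :: "('k::field, 'n::finite) mps \<Rightarrow> ('k, 'n) mps"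
  assumes Aut: "\<sigma> \<in> mps_Aut"
begin

lemma linear: "Vector_Spaces.linear mps_scale mps_scale \<sigma>"
  and continuous: "continuous_on UNIV \<sigma>"
  and bij: "bij \<sigma>"
  and mult: "\<sigma> (f * g) = \<sigma> f * \<sigma> g"
  and one: "\<sigma> 1 = 1"
  using Aut by (auto simp: mps_Aut_def)

lemma add: "\<sigma> (f + g) = \<sigma> f + \<sigma> g"
  and scale: "\<sigma> (mps_scale c f) = mps_scale c (\<sigma> f)"
  using linear by (auto simp: linear_mps_iff)

lemmas sum = linear_mps_sum[OF linear]

lemma zero: "\<sigma> 0 = 0"
  using sum[of "\<lambda>x. x" "{}"] by simp

lemma power: "\<sigma> (f ^ m) = \<sigma> f ^ m"
  by (induction m) (auto simp: one mult)

lemma prod: "\<sigma> (prod f A) = (\<Prod>x\<in>A. \<sigma> (f x))"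
  by (induction A rule: infinite_finite_induct) (auto simp: one mult)

lemma inv_apply [simp]: "inv \<sigma> (\<sigma> f) = f"
  using bij by (simp add: bij_is_inj)

lemma apply_inv [simp]: "\<sigma> (inv \<sigma> f) = f"
  using bij by (simp add: bij_is_surj surj_f_inv_f)

lemma inv_mult: "inv \<sigma> (f * g) = inv \<sigma> f * inv \<sigma> g"
  by (metis inv_apply apply_inv mult)

lemma inv_add: "inv \<sigma> (f + g) = inv \<sigma> f + inv \<sigma> g"
  by (metis inv_apply apply_inv add)

lemma inv_scale: "inv \<sigma> (mps_scale c f) = mps_scale c (inv \<sigma> f)"
  by (metis inv_apply apply_inv scale)

lemma linear_inv: "Vector_Spaces.linear mps_scale mps_scale (inv \<sigma>)"
  by (simp add: linear_mps_iff inv_add inv_scale)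

lemma vpow_images: "vpow (\<lambda>i. \<sigma> (mps_X i)) \<alpha> = \<sigma> (mps_monom \<alpha>)"
  by (simp add: vpow_mps_X[symmetric] vpow_def prod power)

text \<open>The powers of \<open>x\<^sub>i\<close> tend to \<open>0\<close>, hence so do those of \<open>\<sigma> x\<^sub>i\<close> by continuity. The constant
  term of \<open>\<sigma> x\<^sub>i\<close> is therefore nilpotent.\<close>

lemma coeff_image_X: "mps_coeff (\<sigma> (mps_X i)) 0 = 0"
proof -
  have "(\<lambda>m. mps_X i ^ m :: ('k, 'n) mps) \<longlonglongrightarrow> 0"
    unfolding tendsto_mps_iff
  proof
    fix \<alpha> :: "nat ^ 'n"
    show "\<forall>\<^sub>F m in sequentially. mps_coeff (mps_X i ^ m :: ('k, 'n) mps) \<alpha> = mps_coeff 0 \<alpha>"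
      using eventually_gt_at_top[of "\<alpha> $ i"]
      by eventually_elim (auto simp: mps_X_power mps_coeff_monom mps_coeff_0 axis_def)
  qed
  then have "(\<lambda>m. \<sigma> (mps_X i ^ m)) \<longlonglongrightarrow> \<sigma> 0"
    by (rule continuous_on_tendsto_compose[OF continuous]) auto
  then have "\<forall>\<^sub>F m in sequentially. mps_coeff (\<sigma> (mps_X i) ^ m) 0 = 0"
    by (simp add: zero power tendsto_mps_iff mps_coeff_0)
  then obtain m where "mps_coeff (\<sigma> (mps_X i) ^ m) 0 = 0"
    by (auto simp: eventually_sequentially)
  moreover have "mps_coeff (f ^ m) 0 = mps_coeff f 0 ^ m" for f :: "('k, 'n) mps" and m
    by (induction m) (auto simp: mps_coeff_mult_0 mps_coeff_1)
  ultimately show ?thesis by simp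
qed

lemma coeff_0_image:
  assumes "mps_coeff f 0 = 0"
  shows "mps_coeff (\<sigma> f) 0 = 0"
proof -
  from assms have "order_ge (Suc 0) f" by (simp add: order_ge_Suc_0)
  then obtain g where "f = (\<Sum>i\<in>UNIV. mps_X i * g i)"
    by (rule order_ge_Suc_decompose) blast
  then show ?thesis
    by (simp add: sum mult mps_coeff_sum mps_coeff_mult_0 coeff_image_X)
qed

text \<open>Split off the constant term \<open>c\<close> of \<open>\<sigma>\<inverse> f\<close>: applying \<open>\<sigma>\<close> leaves \<open>c\<close> in place and maps the
  rest into the maximal ideal, so \<open>c\<close> is the constant term of \<open>f\<close>.\<close>

lemma coeff_0_inv:
  assumes "mps_coeff f 0 = 0"
  shows "mps_coeff (inv \<sigma> f) 0 = 0"
proof -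
  define c where "c = mps_coeff (inv \<sigma> f) 0"
  define g where "g = inv \<sigma> f - mps_scale c 1"
  have "mps_coeff g 0 = 0"
    by (simp add: g_def c_def mps_coeff_diff mps_coeff_scale mps_coeff_1)
  then have "mps_coeff (\<sigma> g) 0 = 0" by (rule coeff_0_image)
  moreover have "\<sigma> g + mps_scale c 1 = f"
  proof -
    have "\<sigma> (g + mps_scale c 1) = f" by (simp add: g_def)
    then show ?thesis by (simp add: add scale one)
  qed
  then have "mps_coeff f 0 = mps_coeff (\<sigma> g) 0 + c"
    by (auto simp: mps_coeff_add mps_coeff_scale mps_coeff_1)
  ultimately show ?thesis
    using assms by (simp flip: c_def)
qed

lemma order_ge_inv: "order_ge N f \<Longrightarrow> order_ge N (inv \<sigma> f)"
proof (induction N arbitrary: f)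
  case (Suc N)
  from Suc.prems obtain g where f: "f = (\<Sum>i\<in>UNIV. mps_X i * g i)" and g: "\<And>i. order_ge N (g i)"
    by (rule order_ge_Suc_decompose) blast
  have "mps_coeff (mps_X i :: ('k, 'n) mps) 0 = 0" for i
    by (simp add: mps_coeff_X vec_eq_iff axis_def)
  then have "order_ge (Suc 0) (inv \<sigma> (mps_X i))" for i
    unfolding order_ge_Suc_0 by (rule coeff_0_inv)
  then have "order_ge (Suc 0 + N) (inv \<sigma> (mps_X i * g i))" for i
    unfolding inv_mult using Suc.IH[OF g] by (rule order_ge_mult)
  then show ?case
    by (simp add: f linear_mps_sum[OF linear_inv] order_ge_sum)
qed (simp add: order_ge_def)

lemma continuous_inv: "continuous_on UNIV (inv \<sigma>)"
  unfolding continuous_on_mps_iff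
proof
  fix f
  show "(inv \<sigma> \<longlongrightarrow> inv \<sigma> f) (at f)"
    unfolding tendsto_mps_iff
  proof
    fix \<alpha> :: "nat ^ 'n"
    let ?N = "Suc (total_degree \<alpha>)"
    have "\<forall>\<^sub>F g in at f. \<forall>\<beta>\<in>{\<beta>. total_degree \<beta> < ?N}. mps_coeff g \<beta> = mps_coeff f \<beta>"
      by (intro eventually_ball_finite finite_total_degree_less ballI eventually_mps_coeff_eq)
    then show "\<forall>\<^sub>F g in at f. mps_coeff (inv \<sigma> g) \<alpha> = mps_coeff (inv \<sigma> f) \<alpha>"
    proof eventually_elim
      case (elim g)
      then have "order_ge ?N (g - f)" by (auto simp: order_ge_def mps_coeff_diff)
      then have "order_ge ?N (inv \<sigma> (g - f))" by (rule order_ge_inv)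
      moreover have "inv \<sigma> g = inv \<sigma> (g - f) + inv \<sigma> f"
        by (simp flip: inv_add)
      ultimately show ?case by (simp add: order_ge_def mps_coeff_add)
    qed
  qed
qed

end

section \<open>Higher derivations\<close>

text \<open>The higher derivation in the standard coordinates, written coefficientwise so that it
  makes sense on infinite series and its continuity is immediate.\<close>

lift_definition hasse :: "nat ^ 'n::finite \<Rightarrow> ('k::field, 'n) mps \<Rightarrow> ('k, 'n) mps"
  is "\<lambda>\<alpha> f \<gamma>. of_nat (\<Prod>i\<in>UNIV. (\<gamma> + \<alpha>) $ i choose \<alpha> $ i) * f (\<gamma> + \<alpha>)" .

lemma mps_coeff_hasse:
  "mps_coeff (hasse \<alpha> f) \<gamma> =
    of_nat (\<Prod>i\<in>UNIV. (\<gamma> + \<alpha>) $ i choose \<alpha> $ i) * mps_coeff f (\<gamma> + \<alpha>)"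
  by transfer auto

lemma linear_hasse: "Vector_Spaces.linear mps_scale mps_scale (hasse \<alpha>)"
  by (auto simp: linear_mps_iff mps_coeff_hasse mps_coeff_add mps_coeff_scale algebra_simps
      intro!: mps_eqI)

lemma continuous_hasse:
  "continuous_on UNIV (hasse \<alpha> :: ('k::field, 'n::finite) mps \<Rightarrow> ('k, 'n) mps)"
  unfolding continuous_on_mps_iff tendsto_mps_iff
proof (intro allI)
  fix f :: "('k, 'n) mps" and \<gamma> :: "nat ^ 'n"
  show "\<forall>\<^sub>F g in at f. mps_coeff (hasse \<alpha> g) \<gamma> = mps_coeff (hasse \<alpha> f) \<gamma>"
    using eventually_mps_coeff_eq[of "\<gamma> + \<alpha>" f]
    by eventually_elim (simp add: mps_coeff_hasse)
qed

lemma hasse_monom: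
  "hasse \<alpha> (mps_monom \<beta>) =
    mps_scale (of_nat (\<Prod>i\<in>UNIV. (\<beta> $ i) choose (\<alpha> $ i))) (mps_monom (\<beta> - \<alpha>))"
proof (cases "\<alpha> \<le> \<beta>")
  case True
  then have "\<gamma> + \<alpha> = \<beta> \<longleftrightarrow> \<gamma> = \<beta> - \<alpha>" for \<gamma>
    by (auto simp: vec_eq_iff less_eq_vec_def) (metis add_diff_cancel_right')
  moreover have add: "\<beta> - \<alpha> + \<alpha> = \<beta>"
    using True by (auto simp: vec_eq_iff less_eq_vec_def)
  ultimately show ?thesis
    by (intro mps_eqI) (auto simp: mps_coeff_hasse mps_coeff_scale mps_coeff_monom add
        simp del: vector_add_component vector_minus_component)
next
  case False
  then obtain i where "\<beta> $ i < \<alpha> $ i" by (auto simp: less_eq_vec_def not_le)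
  then have prod_0: "(\<Prod>i\<in>UNIV. (\<beta> $ i) choose (\<alpha> $ i)) = 0"
    by (auto intro!: exI[of _ i])
  moreover have "\<gamma> + \<alpha> \<noteq> \<beta>" for \<gamma>
    using False by (auto simp: less_eq_vec_def)
  ultimately show ?thesis
    by (intro mps_eqI) (auto simp: mps_coeff_hasse mps_coeff_scale mps_coeff_monom mps_coeff_0 prod_0 simp del: of_nat_prod)
qed

context mps_automorphism
begin

text \<open>The conjugate satisfies the defining conditions. For uniqueness, precompose with \<open>\<sigma>\<close>: two
  candidates then agree on the monomials in the standard coordinates.\<close>

lemma hderiv_eq: "hderiv (\<lambda>i. \<sigma> (mps_X i)) \<alpha> = \<sigma> \<circ> hasse \<alpha> \<circ> inv \<sigma>"
  unfolding hderiv_def vpow_images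
proof (rule the_equality)
  let ?D = "\<sigma> \<circ> hasse \<alpha> \<circ> inv \<sigma>"
  have lin_hasse: "Vector_Spaces.linear mps_scale mps_scale (hasse \<alpha> :: ('k, 'n) mps \<Rightarrow> ('k, 'n) mps)"
    by (rule linear_hasse)
  have lin: "Vector_Spaces.linear mps_scale mps_scale ?D"
    using lin_hasse linear linear_inv by (simp add: linear_mps_iff)
  have cont: "continuous_on UNIV ?D"
    by (intro continuous_on_compose continuous_inv continuous_on_subset[OF continuous_hasse]
        continuous_on_subset[OF continuous]) auto
  have val: "?D (\<sigma> (mps_monom \<beta>)) =
      mps_scale (of_nat (\<Prod>i\<in>UNIV. (\<beta> $ i) choose (\<alpha> $ i))) (\<sigma> (mps_monom (\<beta> - \<alpha>)))" for \<beta>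
    by (simp add: hasse_monom scale)
  show "Vector_Spaces.linear mps_scale mps_scale ?D \<and> continuous_on UNIV ?D \<and>
     (\<forall>\<beta>. ?D (\<sigma> (mps_monom \<beta>)) =
        mps_scale (of_nat (\<Prod>i\<in>UNIV. (\<beta> $ i) choose (\<alpha> $ i))) (\<sigma> (mps_monom (\<beta> - \<alpha>))))"
    using lin cont val by blast
  fix E
  assume E: "Vector_Spaces.linear mps_scale mps_scale E \<and> continuous_on UNIV E \<and>
     (\<forall>\<beta>. E (\<sigma> (mps_monom \<beta>)) =
        mps_scale (of_nat (\<Prod>i\<in>UNIV. (\<beta> $ i) choose (\<alpha> $ i))) (\<sigma> (mps_monom (\<beta> - \<alpha>))))"
  have "E \<circ> \<sigma> = ?D \<circ> \<sigma>"
  proof (rule linear_continuous_mps_eqI)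
    show "Vector_Spaces.linear mps_scale mps_scale (E \<circ> \<sigma>)"
      "Vector_Spaces.linear mps_scale mps_scale (?D \<circ> \<sigma>)"
      using E lin linear by (auto simp: linear_mps_iff)
    have "continuous_on UNIV (G \<circ> \<sigma>)" if "continuous_on UNIV G" for G :: "('k, 'n) mps \<Rightarrow> ('k, 'n) mps"
      using continuous continuous_on_subset[OF that subset_UNIV] by (rule continuous_on_compose)
    then show "continuous_on UNIV (E \<circ> \<sigma>)" "continuous_on UNIV (?D \<circ> \<sigma>)"
      using E cont by blast+
  qed (use E val in auto)
  then have "E (\<sigma> (inv \<sigma> f)) = ?D (\<sigma> (inv \<sigma> f))" for f
    by (metis comp_apply)
  then show "E = ?D" by auto
qed

end

section \<open>Binomial coefficients in characteristic p\<close>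

text \<open>From \<open>l (p^k choose l) = p^k (p^k - 1 choose l - 1)\<close>: if \<open>p\<close> did not divide the binomial
  coefficient, \<open>p ^ k\<close> would divide \<open>l\<close>.\<close>

lemma of_nat_choose_prime_power_eq_0:
  assumes "CHAR('k::field) = p" "p > 0" and "0 < l" "l < p ^ k"
  shows "(of_nat (p ^ k choose l) :: 'k) = 0"
proof (rule ccontr)
  have p: "prime p"
    using assms prime_CHAR_semidom[where 'a = 'k] by simp
  assume "(of_nat (p ^ k choose l) :: 'k) \<noteq> 0"
  then have "\<not> p dvd p ^ k choose l"
    using assms by (simp add: of_nat_eq_0_iff_char_dvd)
  then have "coprime (p ^ k) (p ^ k choose l)"
    using p by (simp add: prime_imp_coprime)
  moreover have "p ^ k dvd l * (p ^ k choose l)"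
    using times_binomial_minus1_eq[OF \<open>0 < l\<close>, of "p ^ k"] by simp
  ultimately have "p ^ k dvd l"
    using coprime_dvd_mult_left_iff by blast
  with assms show False by (auto dest: dvd_imp_le)
qed

text \<open>A weak form of Lucas' theorem: Vandermonde's identity makes \<open>b \<mapsto> b choose p ^ k\<close> increase
  by \<open>1\<close> when \<open>b\<close> increases by \<open>p ^ k\<close>.\<close>

lemma of_nat_choose_prime_power:
  assumes "CHAR('k::field) = p" "p > 0"
  shows "(of_nat (b choose p ^ k) :: 'k) = of_nat (b div p ^ k)"
proof (induction b rule: less_induct)
  case (less b)
  define q where "q = p ^ k"
  have q: "q > 0" using assms by (simp add: q_def)
  show ?case
  proof (cases "b < q")
    case True
    then show ?thesis by (simp add: q_def binomial_eq_0)
  next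
    case False
    define c where "c = b - q"
    have b: "b = c + q" using False by (simp add: c_def)
    have "(of_nat (b choose q) :: 'k) = (\<Sum>l\<le>q. of_nat (c choose l) * of_nat (q choose (q - l)))"
      unfolding b vandermonde[symmetric] by simp
    also have "\<dots> = (\<Sum>l\<in>{0, q}. of_nat (c choose l) * of_nat (q choose (q - l)))"
      using of_nat_choose_prime_power_eq_0[OF assms, of _ k]
      by (intro sum.mono_neutral_right) (auto simp: q_def)
    also have "\<dots> = 1 + of_nat (c choose q)"
      using q by simp
    also have "\<dots> = 1 + of_nat (c div q)"
      using less.IH[of c] q by (simp add: b q_def)
    also have "\<dots> = of_nat (b div q)"
      using q by (simp add: b)
    finally show ?thesis by (simp add: q_def)
  qed
qed

text \<open>The factors arise from \<open>j\<close> successive applications of the same higher derivation.\<close>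

lemma prod_of_nat_rising:
  "(\<Prod>l<j. of_nat (c + Suc l)) = (of_nat (fact j * ((c + j) choose j)) :: 'k::comm_ring_1)"
proof -
  have "fact c * (\<Prod>l<j. c + Suc l) = (fact (c + j) :: nat)"
    by (induction j) (auto simp: algebra_simps)
  also have "\<dots> = fact c * (fact j * ((c + j) choose j))"
    using binomial_fact_lemma[of j "c + j"] by (simp add: algebra_simps)
  finally have "(\<Prod>l<j. c + Suc l) = fact j * ((c + j) choose j)"
    by simp
  then show ?thesis by (metis of_nat_prod)
qed

section \<open>The diagonal form of the maps phi\<close>

lift_definition mps_diag :: "(nat ^ 'n::finite \<Rightarrow> 'k::field) \<Rightarrow> ('k, 'n) mps \<Rightarrow> ('k, 'n) mps"
  is "\<lambda>w f \<alpha>. w \<alpha> * f \<alpha>" .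

lemma mps_coeff_diag: "mps_coeff (mps_diag w f) \<alpha> = w \<alpha> * mps_coeff f \<alpha>"
  by transfer auto

lemma mps_diag_comp: "mps_diag v \<circ> mps_diag w = mps_diag (\<lambda>\<alpha>. v \<alpha> * w \<alpha>)"
  by (auto intro!: mps_eqI simp: mps_coeff_diag mult.assoc)

text \<open>The eigenvalue of \<open>\<phi>\<^sub>i\<^sub>,\<^sub>k\<close> on the monomials with exponent \<open>b\<close> at \<open>x\<^sub>i\<close>.\<close>

definition phi_weight :: "nat \<Rightarrow> nat \<Rightarrow> nat \<Rightarrow> 'k::field" where
  "phi_weight p k b = (\<Sum>j<p. (- 1) ^ j * of_nat ((b div p ^ k) choose j))"

lemma mps_coeff_hasse_axis_funpow:
  fixes f :: "('k::field, 'n::finite) mps"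
  shows "mps_coeff ((hasse (axis i q) ^^ j) f) \<gamma> =
    (\<Prod>l<j. of_nat ((\<gamma> $ i + Suc l * q) choose q)) * mps_coeff f (\<gamma> + axis i (j * q))"
proof (induction j arbitrary: \<gamma>)
  case 0
  then show ?case by (simp add: axis_nat_0)
next
  case (Suc j)
  have "(\<Prod>i'\<in>UNIV. (\<gamma> + axis i q) $ i' choose axis i q $ i') =
      (\<Prod>i'\<in>UNIV. if i' = i then (\<gamma> $ i + q) choose q else 1)"
    by (intro prod.cong) (auto simp: axis_def)
  also have "\<dots> = (\<gamma> $ i + q) choose q" by simp
  finally have P: "(\<Prod>i'\<in>UNIV. (\<gamma> + axis i q) $ i' choose axis i q $ i') = (\<gamma> $ i + q) choose q" .
  have A: "\<gamma> + axis i q + axis i (j * q) = \<gamma> + axis i (Suc j * q)"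
    by (auto simp: vec_eq_iff axis_def)
  have "mps_coeff ((hasse (axis i q) ^^ Suc j) f) \<gamma> =
      of_nat ((\<gamma> $ i + q) choose q) * mps_coeff ((hasse (axis i q) ^^ j) f) (\<gamma> + axis i q)"
    by (simp only: funpow.simps comp_apply mps_coeff_hasse P)
  also have "\<dots> = of_nat ((\<gamma> $ i + q) choose q) *
      (\<Prod>l<j. of_nat ((\<gamma> $ i + Suc (Suc l) * q) choose q)) * mps_coeff f (\<gamma> + axis i (Suc j * q))"
    unfolding Suc.IH A by (simp add: axis_def algebra_simps)
  also have "of_nat ((\<gamma> $ i + q) choose q) * (\<Prod>l<j. of_nat ((\<gamma> $ i + Suc (Suc l) * q) choose q)) =
      (\<Prod>l<Suc j. of_nat ((\<gamma> $ i + Suc l * q) choose q) :: 'k)"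
    by (subst prod.lessThan_Suc_shift) simp
  finally show ?case .
qed

text \<open>With \<open>q = p ^ k\<close>, the \<open>j\<close> factors of the iterated derivation are the \<open>b choose q\<close> for
  \<open>b = \<beta>\<^sub>i, \<beta>\<^sub>i - q, \<dots>\<close>; modulo \<open>p\<close> they become consecutive numbers descending from
  \<open>\<beta>\<^sub>i div q\<close>, whose product is a falling factorial.\<close>

lemma mps_coeff_X_power_hasse_funpow:
  fixes f :: "('k::field, 'n::finite) mps"
  assumes "CHAR('k) = p" "p > 0"
  shows "mps_coeff (mps_X i ^ (p ^ k * j) * (hasse (axis i (p ^ k)) ^^ j) f) \<beta> =
    of_nat (fact j) * of_nat ((\<beta> $ i div p ^ k) choose j) * mps_coeff f \<beta>"
proof -
  define q where "q = p ^ k"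
  have q: "q > 0" using assms by (simp add: q_def)
  show ?thesis
  proof (cases "j * q \<le> \<beta> $ i")
    case True
    define c where "c = \<beta> $ i div q - j"
    define b where "b = \<beta> $ i - j * q"
    have j: "j \<le> \<beta> $ i div q"
      using True q by (simp add: less_eq_div_iff_mult_less_eq)
    have b: "\<beta> $ i = b + j * q" using True by (simp add: b_def)
    have "b div q = c" using q by (simp add: c_def b)
    then have "(b + Suc l * q) div q = c + Suc l" for l
      using q by (subst div_mult_self1) auto
    then have "(of_nat ((b + Suc l * q) choose q) :: 'k) = of_nat (c + Suc l)" for l
      using of_nat_choose_prime_power[OF assms, of "b + Suc l * q" k, folded q_def] by metis
    then have rising: "(\<Prod>l<j. of_nat ((b + Suc l * q) choose q)) = (\<Prod>l<j. of_nat (c + Suc l) :: 'k)"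
      by simp
    have "\<beta> - axis i (j * q) + axis i (j * q) = \<beta>"
      using True by (auto simp: vec_eq_iff axis_def)
    moreover have "(\<beta> - axis i (j * q)) $ i = b"
      by (simp add: b_def)
    ultimately have "mps_coeff (mps_X i ^ (q * j) * (hasse (axis i q) ^^ j) f) \<beta> =
        (\<Prod>l<j. of_nat (c + Suc l)) * mps_coeff f \<beta>"
      using True unfolding rising[symmetric]
      by (simp add: mps_coeff_X_power_mult mps_coeff_hasse_axis_funpow mult.commute[of q] del: mult_Suc)
    also have "c + j = \<beta> $ i div q" using j by (simp add: c_def)
    then have "(\<Prod>l<j. of_nat (c + Suc l)) = (of_nat (fact j) * of_nat ((\<beta> $ i div q) choose j) :: 'k)"
      unfolding prod_of_nat_rising by (simp only: of_nat_mult)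
    finally show ?thesis by (simp add: q_def)
  next
    case False
    then have "\<beta> $ i div q < j"
      using q by (simp add: div_less_iff_less_mult)
    then show ?thesis
      using False by (simp add: mps_coeff_X_power_mult q_def mult.commute binomial_eq_0)
  qed
qed

lemma phi_weight_0: "p > 0 \<Longrightarrow> phi_weight p k 0 = 1"
proof -
  assume "p > 0"
  have "phi_weight p k 0 = (\<Sum>j<p. if j = 0 then 1 else 0)"
    unfolding phi_weight_def by (intro sum.cong) (auto simp: binomial_eq_0)
  with \<open>p > 0\<close> show ?thesis by simp
qed

text \<open>Here \<open>b div p ^ k\<close> is the leading digit of \<open>b\<close> in base \<open>p\<close>. It is less than \<open>p\<close>, so the
  truncation at \<open>p\<close> in the alternating sum loses nothing.\<close>

lemma phi_weight_top_digit:
  assumes "p ^ k \<le> b" "b < p ^ Suc k"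
  shows "phi_weight p k b = (0 :: 'k::field)"
proof -
  define m where "m = b div p ^ k"
  have pk: "p ^ k > 0" using assms by (auto intro!: Nat.gr0I)
  have "m < p" using assms pk by (simp add: m_def div_less_iff_less_mult)
  have "m > 0" using assms pk by (simp add: m_def div_greater_zero_iff)
  have "phi_weight p k b = (\<Sum>j\<le>m. (- 1) ^ j * of_nat (m choose j) :: 'k)"
    unfolding phi_weight_def m_def[symmetric]
    using \<open>m < p\<close> by (intro sum.mono_neutral_right) (auto simp: binomial_eq_0 not_le simp del: mult_eq_0_iff)
  also have "\<dots> = 0" using \<open>m > 0\<close> by (rule choose_alternating_sum)
  finally show ?thesis .
qed

lemma prod_phi_weight_eq_0:
  assumes "p > 1" "0 < b" "b \<le> K"
  shows "(\<Prod>k\<le>K. phi_weight p k b) = (0 :: 'k::field)"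
proof -
  obtain k where k: "p ^ k \<le> b" "b < p ^ Suc k"
    using ex_power_ivl1[of p b] assms by auto
  (* The leading digit of b sits at a position k below b, so the product reaches it. *)
  have "k < p ^ k" using assms by (simp add: power_gt_expt)
  with k assms have "k \<le> K" by linarith
  with phi_weight_top_digit[OF k] show ?thesis
    by (auto intro!: prod_zero)
qed

context mps_automorphism
begin

abbreviation y :: "'n \<Rightarrow> ('k, 'n) mps" where
  "y \<equiv> \<lambda>i. \<sigma> (mps_X i)"

lemma conj_comp: "(\<sigma> \<circ> A \<circ> inv \<sigma>) \<circ> (\<sigma> \<circ> B \<circ> inv \<sigma>) = \<sigma> \<circ> (A \<circ> B) \<circ> inv \<sigma>"
  by auto

lemma conj_funpow: "((\<sigma> \<circ> A \<circ> inv \<sigma>) ^^ j) u = \<sigma> ((A ^^ j) (inv \<sigma> u))"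
  by (induction j) auto

lemma phi_ik_eq:
  assumes "CHAR('k) = p" "p > 0"
  shows "phi_ik p y i k = \<sigma> \<circ> mps_diag (\<lambda>\<beta>. phi_weight p k (\<beta> $ i)) \<circ> inv \<sigma>"
proof
  fix u
  let ?D = "hasse (axis i (p ^ k))"
  have p: "prime p"
    using assms prime_CHAR_semidom[where 'a = 'k] by simp
  have "phi_ik p y i k u =
      \<sigma> (\<Sum>j<p. mps_scale ((- 1) ^ j / of_nat (fact j)) (mps_X i ^ (p ^ k * j) * (?D ^^ j) (inv \<sigma> u)))"
    by (simp add: phi_ik_def hderiv_eq conj_funpow sum scale mult power)
  also have "(\<Sum>j<p. mps_scale ((- 1) ^ j / of_nat (fact j)) (mps_X i ^ (p ^ k * j) * (?D ^^ j) (inv \<sigma> u))) =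
      mps_diag (\<lambda>\<beta>. phi_weight p k (\<beta> $ i)) (inv \<sigma> u)"
  proof (rule mps_eqI)
    fix \<beta> :: "nat ^ 'n"
    have fact: "(of_nat (fact j) :: 'k) \<noteq> 0" if "j < p" for j
    proof -
      have "\<not> p dvd fact j" using p that by (simp add: prime_dvd_fact_iff)
      then show ?thesis
        using assms(1) by (subst of_nat_eq_0_iff_char_dvd) auto
    qed
    then show "mps_coeff (\<Sum>j<p. mps_scale ((- 1) ^ j / of_nat (fact j))
          (mps_X i ^ (p ^ k * j) * (?D ^^ j) (inv \<sigma> u))) \<beta> =
        mps_coeff (mps_diag (\<lambda>\<beta>. phi_weight p k (\<beta> $ i)) (inv \<sigma> u)) \<beta>"
      by (auto simp: mps_coeff_sum mps_coeff_scale mps_coeff_diag phi_weight_def sum_distrib_right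
          mps_coeff_X_power_hasse_funpow[OF assms] intro!: sum.cong)
  qed
  finally show "phi_ik p y i k u = (\<sigma> \<circ> mps_diag (\<lambda>\<beta>. phi_weight p k (\<beta> $ i)) \<circ> inv \<sigma>) u"
    by simp
qed

lemma phi_upto_eq:
  assumes "CHAR('k) = p" "p > 0"
  shows "phi_upto p y i K = \<sigma> \<circ> mps_diag (\<lambda>\<beta>. \<Prod>k\<le>K. phi_weight p k (\<beta> $ i)) \<circ> inv \<sigma>"
proof (induction K)
  case (Suc K)
  show ?case
    unfolding phi_upto.simps phi_ik_eq[OF assms] Suc conj_comp mps_diag_comp
    by (simp add: mult.commute)
qed (simp add: phi_ik_eq[OF assms])

text \<open>The limit exists because the coefficient of \<open>x ^ \<alpha>\<close> is constant from \<open>K = \<alpha>\<^sub>i\<close> on.\<close>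

lemma phi_i_eq:
  assumes "CHAR('k) = p" "p > 0"
  shows "phi_i p y i = \<sigma> \<circ> mps_diag (\<lambda>\<beta>. of_bool (\<beta> $ i = 0)) \<circ> inv \<sigma>"
proof
  fix u
  have "prime p"
    using assms prime_CHAR_semidom[where 'a = 'k] by simp
  then have "p > 1" by (rule prime_gt_1_nat)
  have "(\<lambda>K. mps_diag (\<lambda>\<beta>. \<Prod>k\<le>K. phi_weight p k (\<beta> $ i)) (inv \<sigma> u)) \<longlonglongrightarrow>
      mps_diag (\<lambda>\<beta>. of_bool (\<beta> $ i = 0)) (inv \<sigma> u)"
    unfolding tendsto_mps_iff
  proof
    fix \<alpha> :: "nat ^ 'n"
    show "\<forall>\<^sub>F K in sequentially.
        mps_coeff (mps_diag (\<lambda>\<beta>. \<Prod>k\<le>K. phi_weight p k (\<beta> $ i)) (inv \<sigma> u)) \<alpha> =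
        mps_coeff (mps_diag (\<lambda>\<beta>. of_bool (\<beta> $ i = 0)) (inv \<sigma> u)) \<alpha>"
      using eventually_ge_at_top[of "\<alpha> $ i"]
    proof eventually_elim
      case (elim K)
      then show ?case
        using prod_phi_weight_eq_0[OF \<open>p > 1\<close> _ elim, where 'k = 'k] \<open>p > 0\<close>
        by (cases "\<alpha> $ i = 0") (simp_all add: mps_coeff_diag phi_weight_0)
    qed
  qed
  then have "(\<lambda>K. phi_upto p y i K u) \<longlonglongrightarrow> \<sigma> (mps_diag (\<lambda>\<beta>. of_bool (\<beta> $ i = 0)) (inv \<sigma> u))"
    unfolding phi_upto_eq[OF assms] comp_apply
    by (rule continuous_on_tendsto_compose[OF continuous]) auto
  then show "phi_i p y i u = (\<sigma> \<circ> mps_diag (\<lambda>\<beta>. of_bool (\<beta> $ i = 0)) \<circ> inv \<sigma>) u"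
    unfolding phi_i_def comp_apply by (rule limI)
qed

text \<open>The maps commute, being simultaneously diagonal, so the fold over the unordered index
  type is well defined. It kills every monomial containing some variable.\<close>

lemma phi_sigma_eq:
  assumes "CHAR('k) = p" "p > 0"
  shows "phi_sigma p \<sigma> u = mps_scale (mps_coeff (inv \<sigma> u) 0) 1"
proof -
  define E where "E = (\<lambda>i. mps_diag (\<lambda>\<beta>. of_bool (\<beta> $ i = 0)) :: ('k, 'n) mps \<Rightarrow> ('k, 'n) mps)"
  let ?F = "\<lambda>i (f :: ('k, 'n) mps \<Rightarrow> ('k, 'n) mps). (\<sigma> \<circ> E i \<circ> inv \<sigma>) \<circ> f"
  have comm: "E i \<circ> E j = E j \<circ> E i" for i j
    by (simp add: E_def mps_diag_comp mult.commute)
  interpret comp_fun_commute ?F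
  proof
    fix i j
    have "?F j (?F i f) = ?F i (?F j f)" for f
      using comm[of i j] by (auto simp: fun_eq_iff)
    then show "?F j \<circ> ?F i = ?F i \<circ> ?F j" by auto
  qed
  have fold: "Finite_Set.fold ?F id A =
      \<sigma> \<circ> mps_diag (\<lambda>\<beta>. of_bool (\<forall>i\<in>A. \<beta> $ i = 0)) \<circ> inv \<sigma>" for A
    using finite[of A]
  proof (induction A rule: finite_induct)
    case empty
    have "mps_diag (\<lambda>\<beta>. 1) f = f" for f :: "('k, 'n) mps"
      by (rule mps_eqI) (simp add: mps_coeff_diag)
    then show ?case by auto
  next
    case (insert i A)
    have "Finite_Set.fold ?F id (insert i A) = ?F i (Finite_Set.fold ?F id A)"
      using insert.hyps by (rule fold_insert)
    then show ?case
      unfolding insert.IH conj_comp unfolding E_def mps_diag_comp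
      by (simp only: of_bool_conj ball_simps)
  qed
  have "(\<forall>i\<in>UNIV. \<beta> $ i = 0) \<longleftrightarrow> \<beta> = 0" for \<beta> :: "nat ^ 'n"
    by (simp add: vec_eq_iff)
  then have "phi_sigma p \<sigma> u = \<sigma> (mps_diag (\<lambda>\<beta>. of_bool (\<beta> = 0)) (inv \<sigma> u))"
    unfolding phi_sigma_def phi_i_eq[OF assms] fold[of UNIV, unfolded E_def] by simp
  also have "mps_diag (\<lambda>\<beta>. of_bool (\<beta> = 0)) (inv \<sigma> u) = mps_scale (mps_coeff (inv \<sigma> u) 0) 1"
    by (rule mps_eqI) (simp add: mps_coeff_diag mps_coeff_scale mps_coeff_1)
  finally show ?thesis by (simp add: scale one)
qed

end

theorem theorem10p2:
  fixes \<sigma> :: "('k::field, 'n::finite) mps \<Rightarrow> ('k, 'n) mps"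
    and a :: "('k, 'n) mps"
    and p :: nat
  assumes "CHAR('k) = p" and "p > 0"
    and "\<sigma> \<in> mps_Aut"
  shows "((\<lambda>\<alpha> :: nat ^ 'n. phi_sigma p \<sigma> (hderiv (\<lambda>i. \<sigma> (mps_X i)) \<alpha> a) * vpow mps_X \<alpha>)
           has_sum inv \<sigma> a) UNIV"
proof -
  interpret mps_automorphism \<sigma>
    using assms(3) by unfold_locales
  have "phi_sigma p \<sigma> (hderiv y \<alpha> a) * vpow mps_X \<alpha> =
      mps_scale (mps_coeff (inv \<sigma> a) \<alpha>) (mps_monom \<alpha>)" for \<alpha>
    by (simp add: phi_sigma_eq[OF assms(1,2)] hderiv_eq mps_coeff_hasse vpow_mps_X
        mps_scale_mult_left)
  then show ?thesis
    using has_sum_mps_monom[of "inv \<sigma> a"] by simp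
qed

end
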